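(* A vector $\Phi\in\mathbb{R}^{10}$ is physically consistent if and only if $f(\Phi)\succ 0$. Furthermore, the inverse transformation from the upper left $3\times 3$ block $\Sigma=\frac12\mathrm{tr}(I)\mathrm{I}_3-I$ of $f(\Phi)$ to the matrix $I\in\mathrm{sym}(3)$ whose components are entries of $\Phi$ reads $I=\mathrm{tr}(\Sigma)\mathrm{I}_3-\Sigma$.
   Context: $\mathrm{I}_p$ is the $p\times p$ identity matrix and $\mathrm{sym}(p)$ the set of real symmetric $p\times p$ matrices; $\succ 0$ means positive definite. For $x=(x_1,x_2,x_3)^\top\in\mathbb{R}^3$ let $\mathcal{S}(x)=\begin{pmatrix}0&-x_3&x_2\\ x_3&0&-x_1\\ -x_2&x_1&0\end{pmatrix}$, so that $\mathcal{S}(x)y=x\times y$. A vector $\Phi\in\mathbb{R}^{10}$ of inertial parameters has entries, in this order, $m,h_1,h_2,h_3,I_{11},I_{22},I_{33},I_{12},I_{23},I_{13}$. Write $h=(h_1,h_2,h_3)^\top\in\mathbb{R}^3$ and $I=\begin{pmatrix}I_{11}&I_{12}&I_{13}\\ I_{12}&I_{22}&I_{23}\\ I_{13}&I_{23}&I_{33}\end{pmatrix}\in\mathrm{sym}(3)$. The map $f:\mathbb{R}^{10}\to\mathrm{sym}(4)$ is $$f(\Phi)=\begin{pmatrix}\Sigma&h\\ h^\top&m\end{pmatrix},\qquad \Sigma=\tfrac12\mathrm{tr}(I)\mathrm{I}_3-I.$$ Definition (physical consistency). $\Phi\in\mathbb{R}^{10}$ with these entries is called physically consistent if there exists a nonnegative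 mass density, specifically a function $\rho:\mathbb{R}^3\to[0,\infty)$, such that $$m=\int_{\mathbb{R}^3}\rho(x)\,\mathrm{d}x,\quad h=\int_{\mathbb{R}^3}\rho(x)x\,\mathrm{d}x,\quad I=\int_{\mathbb{R}^3}\rho(x)\mathcal{S}(x)^\top\mathcal{S}(x)\,\mathrm{d}x$$ hold with $m>0$, where the integrals are evaluated with respect to the Lebesgue measure on $\mathbb{R}^3$ (so $\rho$ is a genuine (measurable) function; point, line or planar mass distributions are excluded). *)

theory Defs
  imports "HOL-Analysis.Analysis"
begin

definition sym_matrices :: "(real ^ 'n ^ 'n) set" where
  "sym_matrices = {A. transpose A = A}"

definition positive_definite :: "real ^ 'n ^ 'n \<Rightarrow> bool" where
  "positive_definite A \<longleftrightarrow> A \<in> sym_matrices \<and> (\<forall>v. v \<noteq> 0 \<longrightarrow> 0 < v \<bullet> (A *v v))"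

definition cross_matrix :: "real ^ 3 \<Rightarrow> real ^ 3 ^ 3" where
  "cross_matrix x = vector
     [vector [0, - x$3, x$2],
      vector [x$3, 0, - x$1],
      vector [- x$2, x$1, 0]]"

(* The entries of a parameter vector are m, h1, h2, h3, I11, I22, I33, I12, I23, I13.
   The index type 10 has 10 = 0, but the numerals 1, ..., 10 are pairwise distinct in it. *)

definition mass :: "real ^ 10 \<Rightarrow> real" where
  "mass \<Phi> = \<Phi>$1"

definition first_moment :: "real ^ 10 \<Rightarrow> real ^ 3" where
  "first_moment \<Phi> = vector [\<Phi>$2, \<Phi>$3, \<Phi>$4]"

definition inertia :: "real ^ 10 \<Rightarrow> real ^ 3 ^ 3" where
  "inertia \<Phi> = vector
     [vector [\<Phi>$5, \<Phi>$8, \<Phi>$10],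
      vector [\<Phi>$8, \<Phi>$6, \<Phi>$9],
      vector [\<Phi>$10, \<Phi>$9, \<Phi>$7]]"

definition Sigma_of_inertia :: "real ^ 3 ^ 3 \<Rightarrow> real ^ 3 ^ 3" where
  "Sigma_of_inertia J = (1/2 * trace J) *\<^sub>R mat 1 - J"

definition block_matrix :: "real ^ 3 ^ 3 \<Rightarrow> real ^ 3 \<Rightarrow> real \<Rightarrow> real ^ 4 ^ 4" where
  "block_matrix S h m = vector
     [vector [S$1$1, S$1$2, S$1$3, h$1],
      vector [S$2$1, S$2$2, S$2$3, h$2],
      vector [S$3$1, S$3$2, S$3$3, h$3],
      vector [h$1, h$2, h$3, m]]"

definition upper_left_block :: "real ^ 4 ^ 4 \<Rightarrow> real ^ 3 ^ 3" where
  "upper_left_block A = vector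
     [vector [A$1$1, A$1$2, A$1$3],
      vector [A$2$1, A$2$2, A$2$3],
      vector [A$3$1, A$3$2, A$3$3]]"

definition pseudo_inertia :: "real ^ 10 \<Rightarrow> real ^ 4 ^ 4" where
  "pseudo_inertia \<Phi> =
     block_matrix (Sigma_of_inertia (inertia \<Phi>)) (first_moment \<Phi>) (mass \<Phi>)"

(* has_bochner_integral includes integrability, so an integral that does not exist
   cannot take the default value 0. *)

definition physically_consistent :: "real ^ 10 \<Rightarrow> bool" where
  "physically_consistent \<Phi> \<longleftrightarrow> mass \<Phi> > 0 \<and>
     (\<exists>\<rho> :: real ^ 3 \<Rightarrow> real.
        \<rho> \<in> borel_measurable lebesgue \<and> (\<forall>x. 0 \<le> \<rho> x) \<and>
        has_bochner_integral lebesgue \<rho> (mass \<Phi>) \<and>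
        has_bochner_integral lebesgue (\<lambda>x. \<rho> x *\<^sub>R x) (first_moment \<Phi>) \<and>
        has_bochner_integral lebesgue
          (\<lambda>x. \<rho> x *\<^sub>R (transpose (cross_matrix x) ** cross_matrix x)) (inertia \<Phi>))"

lemma vector_4_nth [simp]:
  "(vector [a, b, c, d] :: 'a::zero ^ 4) $ 1 = a"
  "(vector [a, b, c, d] :: 'a::zero ^ 4) $ 2 = b"
  "(vector [a, b, c, d] :: 'a::zero ^ 4) $ 3 = c"
  "(vector [a, b, c, d] :: 'a::zero ^ 4) $ 4 = d"
  by (simp_all add: vector_def)

lemma cross_matrix_mult: "cross_matrix x *v y = cross3 x y"
  by (simp add: cross_matrix_def cross3_def vec_eq_iff forall_3 matrix_vector_mult_def sum_3)

lemma inertia_sym: "inertia \<Phi> \<in> sym_matrices"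
  by (simp add: sym_matrices_def inertia_def transpose_def vec_eq_iff forall_3)

lemma pseudo_inertia_sym: "pseudo_inertia \<Phi> \<in> sym_matrices"
  by (simp add: sym_matrices_def pseudo_inertia_def block_matrix_def Sigma_of_inertia_def
      inertia_def mat_def transpose_def vec_eq_iff forall_4)

lemma upper_left_block_pseudo_inertia:
  "upper_left_block (pseudo_inertia \<Phi>) = Sigma_of_inertia (inertia \<Phi>)"
  by (simp add: upper_left_block_def pseudo_inertia_def block_matrix_def vec_eq_iff forall_3)

end

(* With z = (x, 1), the pseudo-inertia matrix of a density rho is the integral of rho z z^T, since
   Sigma_of_inertia sends S(x)^T S(x) to x x^T.  Hence its quadratic form at v is the integral of
   rho (v . z)^2, which is positive for v nonzero because the hyperplane v . z = 0 is a null set.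
   Conversely, let C = Sigma - h h^T / m be the Schur complement of m, which is positive definite,
   and factor C = A A^T.  By rotation invariance the unit ball has first moments 0 and second moments
   proportional to the identity, so a uniform density on the ellipsoid h/m + s A (unit ball)
   has the prescribed moments for a suitable scale s. *)

theory Submission
  imports Defs
begin

section \<open>Affine changes of variables and moments of balls\<close>

lemma absolutely_integrable_on_compact:
  fixes f :: "'a::euclidean_space \<Rightarrow> real"
  assumes "compact S" and "continuous_on UNIV f"
  shows "f absolutely_integrable_on S"
proof -
  have *: "integrable lborel (\<lambda>x. indicator S x *\<^sub>R f x)"
    using assms continuous_on_subset[of UNIV f S] by (intro borel_integrable_compact) auto
  then show ?thesis
    unfolding set_integrable_def
    using integrable_completion[OF borel_measurable_integrable[OF *]] by blast
qed

lemma integral_cball_const: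
  "integral (cball p r) (\<lambda>u. c :: real) = measure lborel (cball p r) * c"
proof -
  have "integral (cball p r) (\<lambda>u. 1 :: real) = measure lborel (cball p r)"
    using lmeasure_integral[OF lmeasurable_cball[of p r]] by simp
  then show ?thesis
    using integral_mult_left[of "cball p r" "\<lambda>u. 1 :: real" c] by simp
qed

lemma integral_affine_image:
  fixes f :: "real ^ 'n::{finite,wellorder} \<Rightarrow> real" and A :: "real ^ 'n::_ ^ 'n::_"
  assumes "compact S" and det: "det A \<noteq> 0" and f: "continuous_on UNIV f"
  shows "f absolutely_integrable_on (\<lambda>u. p + A *v u) ` S"
    and "integral ((\<lambda>u. p + A *v u) ` S) f = \<bar>det A\<bar> * integral S (\<lambda>u. f (p + A *v u))"
proof -
  \<comment> \<open>The change-of-variables theorem \<open>integral_change_of_variables\<close> is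
    about vector-valued integrands, so f travels as the one-component vector field \<open>?F\<close>
    and is read off again through component 1.\<close>
  let ?g = "\<lambda>u. p + A *v u" and ?F = "\<lambda>x. vec (f x) :: real ^ 1"
  have lin: "linear ((*v) A)" by simp
  have cont: "continuous_on T ?g" for T
    by (intro continuous_intros linear_continuous_on linear_conv_bounded_linear[THEN iffD1] lin)
  have "compact (?g ` S)"
    using cont assms(1) by (rule compact_continuous_image)
  then show *: "f absolutely_integrable_on ?g ` S"
    using f by (rule absolutely_integrable_on_compact)
  have S: "S \<in> sets lebesgue"
    using assms(1) by (simp add: compact_imp_closed lmeasurable_compact fmeasurableD)
  have "inj ((*v) A)"
    using det by (metis det_nz_iff_inj lin matrix_of_matrix_vector_mul)
  then have "inj_on ?g S"
    by (auto simp: inj_on_def)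
  moreover have "(?g has_derivative (*v) A) (at x within S)" for x
    by (auto intro!: derivative_eq_intros bounded_linear_imp_has_derivative
        simp: linear_conv_bounded_linear[symmetric])
  moreover have "?F absolutely_integrable_on ?g ` S"
    using * by (simp add: absolutely_integrable_on_1_iff)
  ultimately have "integral (?g ` S) ?F = integral S (\<lambda>x. \<bar>det (matrix ((*v) A))\<bar> *\<^sub>R ?F (?g x))"
    using S by (intro integral_change_of_variables) auto
  then have "integral (?g ` S) ?F $ 1 = integral S (\<lambda>x. \<bar>det A\<bar> *\<^sub>R ?F (?g x)) $ 1"
    by simp
  then show "integral (?g ` S) f = \<bar>det A\<bar> * integral S (\<lambda>u. f (?g u))"
    by (simp add: integral_on_1_eq)
qed

text \<open>An orthogonal map preserves volume and maps the centred ball onto itself, so this is a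
  change of variables with determinant of absolute value 1.\<close>

lemma integral_cball_orthogonal:
  fixes f :: "real ^ 'n::{finite,wellorder} \<Rightarrow> real"
  fixes T :: "real ^ 'n::_ \<Rightarrow> real ^ 'n::_"
  assumes T: "orthogonal_transformation T" and f: "continuous_on UNIV f"
  shows "integral (cball 0 r) (\<lambda>u. f (T u)) = integral (cball 0 r) f"
proof -
  have lin: "linear T"
    using T by (simp add: orthogonal_transformation)
  have "\<bar>det (matrix T)\<bar> = 1"
    using T by (metis orthogonal_transformation_det)
  moreover have "T ` cball 0 r = cball 0 r"
    using image_orthogonal_transformation_cball[OF T, of 0 r] lin by (simp add: linear_0)
  moreover have "(\<lambda>u. 0 + matrix T *v u) = T"
    using matrix_vector_mul(2)[OF lin] by auto
  ultimately show ?thesis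
    using integral_affine_image(2)[of "cball 0 r" "matrix T" f 0] f matrix_vector_mul(2)[OF lin]
    by auto
qed

text \<open>The reflection \<open>uminus\<close> is orthogonal and negates the integrand, so the
  integral equals its own negative.\<close>

lemma integral_cball_inner:
  fixes a :: "real ^ 'n::{finite,wellorder}"
  shows "integral (cball 0 r) (\<lambda>u. u \<bullet> a) = 0"
proof -
  have "orthogonal_transformation (uminus :: real ^ 'n::_ \<Rightarrow> _)"
    by (simp add: orthogonal_transformation_def linear_uminus)
  from integral_cball_orthogonal[OF this, of "\<lambda>u. u \<bullet> a" r] show ?thesis
    by (simp add: continuous_intros)
qed

text \<open>The quadratic form given by the integral of (u . a)^2 is rotation invariant, hence
  constant on unit vectors. Homogeneity extends this to all vectors, and polarization to the
  bilinear form.\<close>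

lemma integral_cball_inner_inner:
  obtains c where "c > 0"
    and "\<And>a b. integral (cball 0 1) (\<lambda>u :: real ^ 'n::{finite,wellorder}. (u \<bullet> a) * (u \<bullet> b)) = c * (a \<bullet> b)"
proof -
  let ?B = "cball 0 1 :: (real ^ 'n::_) set"
  \<comment> \<open>Any coordinate axis serves as the reference direction, since rotations act
    transitively on unit vectors.\<close>
  let ?e = "axis undefined 1 :: real ^ 'n::_"
  define q where "q a b = integral ?B (\<lambda>u. (u \<bullet> a) * (u \<bullet> b))" for a b
  have int: "f integrable_on cball p r" if "continuous_on UNIV f" for f :: "real ^ 'n::_ \<Rightarrow> real" and p r
    using that by (metis compact_cball absolutely_integrable_on_compact set_lebesgue_integral_eq_integral(1))
  have e: "norm ?e = 1" by simp
  define c where "c = q ?e ?e"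
  have unit: "q a a = c" if "norm a = 1" for a
  proof -
    obtain T where T: "orthogonal_transformation T" "T ?e = a"
      using orthogonal_transformation_exists_1[OF e \<open>norm a = 1\<close>] by blast
    have "q a a = integral ?B (\<lambda>u. (T u \<bullet> a) * (T u \<bullet> a))"
      unfolding q_def by (rule integral_cball_orthogonal[OF T(1), symmetric]) (intro continuous_intros)
    also have "\<dots> = q ?e ?e"
      using T unfolding q_def orthogonal_transformation_def by metis
    finally show ?thesis by (simp add: c_def)
  qed
  have square: "q a a = c * (a \<bullet> a)" for a
  proof (cases "a = 0")
    case True then show ?thesis by (simp add: q_def)
  next
    case False
    have "q a a = integral ?B (\<lambda>u. (norm a)\<^sup>2 * ((u \<bullet> sgn a) * (u \<bullet> sgn a)))"
      using False unfolding q_def by (simp add: sgn_div_norm power2_eq_square field_simps)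
    also have "\<dots> = (norm a)\<^sup>2 * q (sgn a) (sgn a)"
      unfolding q_def by simp
    finally show ?thesis
      using unit[of "sgn a"] False by (simp add: norm_sgn power2_norm_eq_inner)
  qed
  have "q a b = c * (a \<bullet> b)" for a b \<comment> \<open>by polarization\<close>
  proof -
    have "q (a + b) (a + b) - q (a - b) (a - b) =
        integral ?B (\<lambda>u. (u \<bullet> (a + b)) * (u \<bullet> (a + b)) - (u \<bullet> (a - b)) * (u \<bullet> (a - b)))"
      unfolding q_def
      by (rule integral_diff[symmetric]; intro int continuous_intros)
    also have "\<dots> = integral ?B (\<lambda>u. 4 * ((u \<bullet> a) * (u \<bullet> b)))"
      by (simp add: inner_diff_right inner_add_right algebra_simps)
    also have "\<dots> = 4 * q a b"
      by (simp add: q_def)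
    finally have "4 * q a b = c * ((a + b) \<bullet> (a + b)) - c * ((a - b) \<bullet> (a - b))"
      by (simp only: square)
    then show ?thesis
      by (simp add: inner_diff inner_add_left inner_add_right inner_commute algebra_simps)
  qed
  moreover have "c > 0"
  proof -
    \<comment> \<open>Points of this ball have norm at most 3/4 and \<open>?e\<close>-coordinate at
      least 1/4, so the integrand of \<open>c\<close> is at least 1/16 on a subset of the unit ball
      of positive volume.\<close>
    let ?D = "cball ((1/2) *\<^sub>R ?e) (1/4)"
    have D: "1/4 \<le> u \<bullet> ?e \<and> u \<in> ?B" if "u \<in> ?D" for u
    proof -
      have 1: "norm (u - (1/2) *\<^sub>R ?e) \<le> 1/4"
        using that by (simp add: dist_norm norm_minus_commute)
      have "norm u \<le> norm (u - (1/2) *\<^sub>R ?e) + norm ((1/2) *\<^sub>R ?e)"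
        by (metis diff_add_cancel norm_triangle_ineq)
      moreover have "\<bar>(u - (1/2) *\<^sub>R ?e) \<bullet> ?e\<bar> \<le> 1/4"
        using Cauchy_Schwarz_ineq2[of "u - (1/2) *\<^sub>R ?e" ?e] 1 by simp
      ultimately show ?thesis
        using 1 abs_le_D2 by (fastforce simp: inner_diff_left)
    qed
    have "0 < integral ?D (\<lambda>u. 1/16 :: real)"
      using content_cball_pos[of "1/4" "(1/2) *\<^sub>R ?e"]
      by (simp add: integral_cball_const del: integral_const)
    also have "\<dots> \<le> integral ?D (\<lambda>u. (u \<bullet> ?e) * (u \<bullet> ?e))"
    proof (rule integral_le)
      fix u assume "u \<in> ?D"
      then have "1/4 * (1/4) \<le> (u \<bullet> ?e) * (u \<bullet> ?e)"
        using D by (intro mult_mono) force+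
      then show "1/16 \<le> (u \<bullet> ?e) * (u \<bullet> ?e)" by simp
    qed (intro int continuous_intros)+
    also have "\<dots> \<le> c"
      unfolding c_def q_def using D by (intro integral_subset_le int continuous_intros) auto
    finally show ?thesis .
  qed
  ultimately show thesis
    using that unfolding q_def by blast
qed

section \<open>Cholesky factors and ellipsoids with prescribed moments\<close>

lemma sym_matrices_nth:
  assumes "A \<in> sym_matrices"
  shows "A $ i $ j = A $ j $ i"
proof -
  have "A $ i $ j = transpose A $ j $ i" by (simp add: transpose_def)
  also have "transpose A = A" using assms by (simp add: sym_matrices_def)
  finally show ?thesis .
qed

text \<open>The entries of a lower triangular factor are solved for one after another. Each pivot
  under a square root is positive because it is a value of the quadratic form at a nonzero
  vector.\<close>

lemma cholesky_3:
  fixes C :: "real ^ 3 ^ 3"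
  assumes "positive_definite C"
  obtains A :: "real ^ 3 ^ 3" where "C = A ** transpose A"
proof -
  have "C \<in> sym_matrices"
    using assms by (simp add: positive_definite_def)
  note sym = sym_matrices_nth[OF this, of 2 1] sym_matrices_nth[OF this, of 3 1]
    sym_matrices_nth[OF this, of 3 2]
  have pos: "0 < v \<bullet> (C *v v)" if "v \<noteq> 0" for v
    using assms that by (simp add: positive_definite_def)
  have quad: "v \<bullet> (C *v v) = C$1$1 * v$1 * v$1 + C$2$2 * v$2 * v$2 + C$3$3 * v$3 * v$3
     + 2 * C$1$2 * v$1 * v$2 + 2 * C$1$3 * v$1 * v$3 + 2 * C$2$3 * v$2 * v$3" for v
    by (simp add: inner_vec_def matrix_vector_mult_def sum_3 sym algebra_simps)
  define a where "a = sqrt (C$1$1)"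
  have "0 < C$1$1"
    using pos[of "vector [1,0,0]"] by (simp add: quad vec_eq_iff forall_3)
  then have a: "a > 0" "C$1$1 = a * a" by (simp_all add: a_def)
  define b d where "b = C$1$2 / a" and "d = C$1$3 / a"
  have bd: "C$1$2 = a * b" "C$1$3 = a * d" using a by (simp_all add: b_def d_def)
  \<comment> \<open>The test vector makes the square (a x + b y)^2 vanish, leaving exactly the
    second pivot.\<close>
  have "0 < C$2$2 - b * b"
    using pos[of "vector [- b / a, 1, 0]"] a by (simp add: quad vec_eq_iff forall_3 bd)
  moreover define e where "e = sqrt (C$2$2 - b * b)"
  ultimately have e: "e > 0" "C$2$2 = b * b + e * e" by simp_all
  define f where "f = (C$2$3 - b * d) / e"
  have f: "C$2$3 = b * d + e * f" using e by (simp add: f_def)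
  \<comment> \<open>Back substitution: x and y annihilate the first two squares in the form at (x,
    y, 1), which leaves the third pivot.\<close>
  define y where "y = - f / e"
  define x where "x = - (b * y + d) / a"
  have xy: "a * x + b * y + d = 0" "e * y + f = 0"
    using a e by (simp_all add: x_def y_def)
  have "0 < vector [x, y, 1] \<bullet> (C *v vector [x, y, 1])"
    by (rule pos) (simp add: vec_eq_iff forall_3)
  also have "\<dots> = (a * x + b * y + d)\<^sup>2 + (e * y + f)\<^sup>2 + (C$3$3 - d * d - f * f)"
    by (simp add: quad a e bd f power2_eq_square algebra_simps)
  finally have "0 < C$3$3 - d * d - f * f"
    by (simp add: xy)
  moreover define g where "g = sqrt (C$3$3 - d * d - f * f)"
  ultimately have g: "C$3$3 = d * d + f * f + g * g" by simp
  let ?A = "vector [vector [a, 0, 0], vector [b, e, 0], vector [d, f, g]] :: real ^ 3 ^ 3"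
  have "C = ?A ** transpose ?A"
    by (simp add: vec_eq_iff forall_3 matrix_matrix_mult_def transpose_def sum_3 sym a bd e(2) f g
        mult.commute)
  then show thesis by (rule that)
qed

text \<open>Testing moments against arbitrary vectors avoids indices: as the last inner product is a
  . (A A^T b), the density has mass m, centre p and second moment matrix A A^T about p.\<close>

lemma ellipsoid_density:
  fixes A :: "real ^ 'n::{finite,wellorder} ^ 'n::_" and p :: "real ^ 'n::_"
  assumes det: "det A \<noteq> 0" and m: "m > 0"
  obtains \<rho> where "\<rho> \<in> borel_measurable lebesgue" "\<And>x. 0 \<le> \<rho> x"
    "has_bochner_integral lebesgue \<rho> m"
    "\<And>a. has_bochner_integral lebesgue (\<lambda>x. \<rho> x * (x \<bullet> a)) (m * (p \<bullet> a))"
    "\<And>a b. has_bochner_integral lebesgue (\<lambda>x. \<rho> x * ((x \<bullet> a) * (x \<bullet> b)))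
       (m * ((p \<bullet> a) * (p \<bullet> b)) + (transpose A *v a) \<bullet> (transpose A *v b))"
proof -
  let ?S = "cball 0 1 :: (real ^ 'n::_) set"
  obtain c where c: "c > 0"
    "\<And>a b. integral ?S (\<lambda>u. (u \<bullet> a) * (u \<bullet> b)) = c * (a \<bullet> b)"
    using integral_cball_inner_inner by metis
  define V where "V = measure lborel ?S"
  have V: "V > 0" unfolding V_def by (rule content_cball_pos) simp
  \<comment> \<open>The uniform density of mass m on the ellipsoid has second moments (m / V) c s^2
    A A^T about p; this s makes the scalar factor 1.\<close>
  define s where "s = sqrt (V / (c * m))"
  have s: "s > 0" "s * s = V / (c * m)" using V c m by (simp_all add: s_def)
  define B where "B = s *\<^sub>R A"
  have "inj ((*v) B)"
    using s det det_nz_iff_inj[of "(*v) A"]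
    by (simp add: inj_on_def B_def flip: scaleR_matrix_vector_assoc)
  then have detB: "det B \<noteq> 0" using det_nz_iff_inj[of "(*v) B"] by simp
  define E where "E = (\<lambda>u. p + B *v u) ` ?S"
  \<comment> \<open>The mass divided by the volume of \<open>E\<close>.\<close>
  define k where "k = m / (\<bar>det B\<bar> * V)"
  define \<rho> where "\<rho> x = k * indicator E x" for x
  have k: "k \<ge> 0" using m V by (simp add: k_def)
  have int: "f integrable_on ?S" if "continuous_on UNIV f" for f :: "real ^ 'n::_ \<Rightarrow> real"
    using that by (metis compact_cball absolutely_integrable_on_compact set_lebesgue_integral_eq_integral(1))
  \<comment> \<open>Integrating against the density is m times averaging over the unit ball: the
    Jacobian determinant cancels against the one in \<open>k\<close>.\<close>
  have \<rho>: "has_bochner_integral lebesgue (\<lambda>x. \<rho> x * f x) y"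
    if f: "continuous_on UNIV f" and y: "y = m / V * integral ?S (\<lambda>u. f (p + B *v u))" for f y
  proof -
    note aff = integral_affine_image[OF compact_cball detB f, of p 0 1, folded E_def]
    have "has_bochner_integral lebesgue (\<lambda>x. indicator E x *\<^sub>R f x) (integral E f)"
      using aff(1) set_lebesgue_integral_eq_integral(2)[OF aff(1)]
      unfolding has_bochner_integral_iff set_integrable_def set_lebesgue_integral_def by simp
    then have "has_bochner_integral lebesgue (\<lambda>x. k * (indicator E x *\<^sub>R f x)) (k * integral E f)"
      by (rule has_bochner_integral_mult_right)
    moreover have "k * integral E f = y"
      using detB by (simp add: aff(2) y k_def)
    ultimately show ?thesis
      by (simp add: \<rho>_def mult.assoc)
  qed
  have B: "(p + B *v u) \<bullet> a = p \<bullet> a + u \<bullet> (transpose B *v a)" for a u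
    by (simp add: inner_add_left) (metis dot_lmul_matrix inner_commute)
  have const: "integral ?S (\<lambda>u. r) = V * r" for r :: real
    by (simp add: V_def integral_cball_const)
  have m1: "has_bochner_integral lebesgue \<rho> m"
    using \<rho>[of "\<lambda>x. 1" m] V by (simp add: const)
  show thesis
  proof (rule that)
    show "\<rho> \<in> borel_measurable lebesgue"
      using m1 by (rule borel_measurable_has_bochner_integral)
    show "0 \<le> \<rho> x" for x using k by (simp add: \<rho>_def)
    show "has_bochner_integral lebesgue \<rho> m" by fact
  next
    fix a
    have "integral ?S (\<lambda>u. (p + B *v u) \<bullet> a)
        = integral ?S (\<lambda>u. p \<bullet> a) + integral ?S (\<lambda>u. u \<bullet> (transpose B *v a))"
      unfolding B by (intro integral_add int continuous_intros)
    also have "\<dots> = V * (p \<bullet> a)"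
      by (simp only: const integral_cball_inner)
    finally show "has_bochner_integral lebesgue (\<lambda>x. \<rho> x * (x \<bullet> a)) (m * (p \<bullet> a))"
      using V by (intro \<rho> continuous_intros) simp
  next
    fix a b
    let ?a = "transpose B *v a" and ?b = "transpose B *v b"
    \<comment> \<open>The terms linear in u of the expanded product collect into u .
      \<open>?w\<close>, which integrates to 0 by symmetry.\<close>
    let ?w = "(p \<bullet> a) *\<^sub>R ?b + (p \<bullet> b) *\<^sub>R ?a"
    have "integral ?S (\<lambda>u. ((p + B *v u) \<bullet> a) * ((p + B *v u) \<bullet> b))
        = integral ?S (\<lambda>u. (p \<bullet> a) * (p \<bullet> b) + (u \<bullet> ?w + (u \<bullet> ?a) * (u \<bullet> ?b)))"
      unfolding B by (simp add: inner_add_right algebra_simps)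
    also have "\<dots> = integral ?S (\<lambda>u. (p \<bullet> a) * (p \<bullet> b))
        + integral ?S (\<lambda>u. u \<bullet> ?w + (u \<bullet> ?a) * (u \<bullet> ?b))"
      by (intro integral_add int continuous_intros)
    also have "integral ?S (\<lambda>u. u \<bullet> ?w + (u \<bullet> ?a) * (u \<bullet> ?b))
        = integral ?S (\<lambda>u. u \<bullet> ?w) + integral ?S (\<lambda>u. (u \<bullet> ?a) * (u \<bullet> ?b))"
      by (intro integral_add int continuous_intros)
    also have "integral ?S (\<lambda>u. (p \<bullet> a) * (p \<bullet> b)) + \<dots> = V * ((p \<bullet> a) * (p \<bullet> b)) + c * (?a \<bullet> ?b)"
      by (simp only: const integral_cball_inner c(2))
    also have "?a \<bullet> ?b = s * s * ((transpose A *v a) \<bullet> (transpose A *v b))"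
      by (simp add: B_def transpose_scalar scaleR_matrix_vector_assoc[symmetric])
    finally show "has_bochner_integral lebesgue (\<lambda>x. \<rho> x * ((x \<bullet> a) * (x \<bullet> b)))
       (m * ((p \<bullet> a) * (p \<bullet> b)) + (transpose A *v a) \<bullet> (transpose A *v b))"
      using V c m by (intro \<rho> continuous_intros) (simp add: s field_simps)
  qed
qed

section \<open>Moments of a density as entries of the pseudo-inertia matrix\<close>

lemma has_bochner_integral_vec_iff:
  fixes f :: "'a \<Rightarrow> 'b::euclidean_space ^ 'n"
  shows "has_bochner_integral M f y \<longleftrightarrow> (\<forall>i. has_bochner_integral M (\<lambda>x. f x $ i) (y $ i))"
proof
  assume "has_bochner_integral M f y"
  then show "\<forall>i. has_bochner_integral M (\<lambda>x. f x $ i) (y $ i)"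
    using has_bochner_integral_bounded_linear[OF bounded_linear_vec_nth] by blast
next
  assume *: "\<forall>i. has_bochner_integral M (\<lambda>x. f x $ i) (y $ i)"
  \<comment> \<open>The embeddings \<open>axis i\<close> are bounded linear, so integrals of the
    components reassemble to the integral of the vector. With vectors as components, the same
    argument covers matrices.\<close>
  have sum_axis: "(\<Sum>i\<in>UNIV. axis i (z $ i)) = z" for z :: "'b ^ 'n"
    by (simp add: vec_eq_iff axis_def if_distrib cong: if_cong)
  have "bounded_linear (axis i :: 'b \<Rightarrow> 'b ^ 'n)" for i
    by (auto simp: linear_conv_bounded_linear[symmetric] linear_iff vec_eq_iff axis_def)
  then have "has_bochner_integral M (\<lambda>x. \<Sum>i\<in>UNIV. axis i (f x $ i)) (\<Sum>i\<in>UNIV. axis i (y $ i))"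
    by (intro has_bochner_integral_sum has_bochner_integral_bounded_linear[OF _ spec[OF *]])
  then show "has_bochner_integral M f y"
    by (simp only: sum_axis)
qed

text \<open>Since the identity has trace 3, trace Sigma = (3/2 - 1) trace J = (1/2) trace J;
  conversely \<open>trace S *\<^sub>R mat 1 - S\<close> has trace 2 trace S.\<close>

lemma Sigma_of_inertia_inverse:
  "trace (Sigma_of_inertia J) *\<^sub>R mat 1 - Sigma_of_inertia J = J"
  "Sigma_of_inertia (trace S *\<^sub>R mat 1 - S) = S"
  by (simp_all add: Sigma_of_inertia_def trace_def sum_3 mat_def vec_eq_iff forall_3 field_simps)

lemma sym_matrices_trace_diff: "S \<in> sym_matrices \<Longrightarrow> r *\<^sub>R mat 1 - S \<in> sym_matrices"
  by (simp add: sym_matrices_def transpose_def mat_def vec_eq_iff)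

text \<open>Here S(x)^T S(x) = |x|^2 I - x x^T, and |x|^2 is the trace of x x^T, so this is the
  inverse map applied to x x^T.\<close>

lemma Sigma_of_inertia_cross_matrix:
  "Sigma_of_inertia (r *\<^sub>R (transpose (cross_matrix x) ** cross_matrix x)) = r *\<^sub>R (\<chi> i j. x $ i * x $ j)"
  by (simp add: Sigma_of_inertia_def cross_matrix_def trace_def sum_3 mat_def vec_eq_iff forall_3
      matrix_matrix_mult_def transpose_def field_simps)

definition homogenize :: "real ^ 3 \<Rightarrow> real ^ 4" where
  "homogenize x = vector [x $ 1, x $ 2, x $ 3, 1]"

text \<open>Bounded linear maps carry over both integrability and the value of an integral; the two
  directions use the two mutually inverse maps.\<close>

lemma has_bochner_integral_inertia_iff:
  "has_bochner_integral lebesgue (\<lambda>x. \<rho> x *\<^sub>R (transpose (cross_matrix x) ** cross_matrix x)) J \<longleftrightarrow>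
   has_bochner_integral lebesgue (\<lambda>x. \<rho> x *\<^sub>R (\<chi> i j. x $ i * x $ j)) (Sigma_of_inertia J)" (is "?L \<longleftrightarrow> ?R")
proof
  have "bounded_linear Sigma_of_inertia"
    by (auto simp: linear_conv_bounded_linear[symmetric] linear_iff vec_eq_iff Sigma_of_inertia_def
        trace_def sum_3 mat_def field_simps)
  moreover assume ?L
  ultimately have "has_bochner_integral lebesgue
     (\<lambda>x. Sigma_of_inertia (\<rho> x *\<^sub>R (transpose (cross_matrix x) ** cross_matrix x))) (Sigma_of_inertia J)"
    by (rule has_bochner_integral_bounded_linear)
  then show ?R by (simp only: Sigma_of_inertia_cross_matrix)
next
  let ?T = "\<lambda>S :: real ^ 3 ^ 3. trace S *\<^sub>R mat 1 - S"
  have "bounded_linear ?T"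
    by (auto simp: linear_conv_bounded_linear[symmetric] linear_iff vec_eq_iff
        trace_def sum_3 mat_def field_simps)
  moreover assume ?R
  ultimately have "has_bochner_integral lebesgue
     (\<lambda>x. ?T (\<rho> x *\<^sub>R (\<chi> i j. x $ i * x $ j))) (?T (Sigma_of_inertia J))"
    by (rule has_bochner_integral_bounded_linear)
  then show ?L
    by (simp only: Sigma_of_inertia_cross_matrix[symmetric] Sigma_of_inertia_inverse)
qed

text \<open>The final 1 in \<open>homogenize x\<close> makes mass, first moments and second moments
  entries of one matrix integral, so both directions of the theorem can work with a single family of
  scalar integrals.\<close>

lemma physically_consistent_iff:
  "physically_consistent \<Phi> \<longleftrightarrow> mass \<Phi> > 0 \<and>
     (\<exists>\<rho>. \<rho> \<in> borel_measurable lebesgue \<and> (\<forall>x. 0 \<le> \<rho> x) \<and>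
        (\<forall>i j. has_bochner_integral lebesgue (\<lambda>x. \<rho> x * (homogenize x $ i * homogenize x $ j))
                 (pseudo_inertia \<Phi> $ i $ j)))"
proof -
  have "has_bochner_integral lebesgue \<rho> (mass \<Phi>) \<and>
        has_bochner_integral lebesgue (\<lambda>x. \<rho> x *\<^sub>R x) (first_moment \<Phi>) \<and>
        has_bochner_integral lebesgue
          (\<lambda>x. \<rho> x *\<^sub>R (transpose (cross_matrix x) ** cross_matrix x)) (inertia \<Phi>) \<longleftrightarrow>
        (\<forall>i j. has_bochner_integral lebesgue (\<lambda>x. \<rho> x * (homogenize x $ i * homogenize x $ j))
                 (pseudo_inertia \<Phi> $ i $ j))" for \<rho>
    unfolding has_bochner_integral_inertia_iff
    unfolding has_bochner_integral_vec_iff forall_3 forall_4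
    by (auto simp: pseudo_inertia_def block_matrix_def homogenize_def mult.commute)
  then show ?thesis
    unfolding physically_consistent_def by simp
qed

section \<open>Physical consistency implies positive definiteness\<close>

lemma negligible_homogenize:
  assumes "v \<noteq> 0"
  shows "negligible {x. v \<bullet> homogenize x = 0}"
proof -
  let ?a = "vector [v $ 1, v $ 2, v $ 3] :: real ^ 3"
  have eq: "v \<bullet> homogenize x = ?a \<bullet> x + v $ 4" for x
    by (simp add: homogenize_def inner_vec_def sum_3 sum_4)
  show ?thesis
  \<comment> \<open>The affine function is either a nonzero constant, with empty zero set, or
    vanishes on a genuine hyperplane.\<close>
  proof (cases "?a = 0")
    case True
    then have "v $ 4 \<noteq> 0"
      using assms by (simp add: vec_eq_iff forall_3 forall_4)
    then show ?thesis unfolding eq by (simp add: True)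
  next
    case False
    then have "negligible {x. ?a \<bullet> x = - v $ 4}"
      by (intro negligible_hyperplane) simp
    then show ?thesis unfolding eq by (simp add: add_eq_0_iff2)
  qed
qed

lemma quadratic_form:
  fixes P :: "real ^ 'n ^ 'n"
  shows "v \<bullet> (P *v w) = (\<Sum>i\<in>UNIV. \<Sum>j\<in>UNIV. v $ i * w $ j * P $ i $ j)"
  by (simp add: inner_vec_def matrix_vector_mult_def sum_distrib_left algebra_simps)

text \<open>Keeping the last coordinate t separate allows completing the square in t, which produces
  the Schur complement.\<close>

lemma block_matrix_quadratic_form:
  fixes v h :: "real ^ 3" and t m :: real
  defines "w \<equiv> vector [v $ 1, v $ 2, v $ 3, t] :: real ^ 4"
  shows "w \<bullet> (block_matrix S h m *v w) = v \<bullet> (S *v v) + 2 * t * (h \<bullet> v) + m * t * t"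
  unfolding quadratic_form
  by (simp add: w_def block_matrix_def sum_4 sum_3 inner_vec_def algebra_simps)

lemma positive_definite_if_physically_consistent:
  assumes "physically_consistent \<Phi>"
  shows "positive_definite (pseudo_inertia \<Phi>)"
  unfolding positive_definite_def
proof (intro conjI allI impI)
  let ?P = "pseudo_inertia \<Phi>"
  show "?P \<in> sym_matrices" by (rule pseudo_inertia_sym)
  fix v :: "real ^ 4" assume v: "v \<noteq> 0"
  obtain \<rho> where m: "mass \<Phi> > 0" and \<rho>: "\<And>x. 0 \<le> \<rho> x"
    and P: "\<And>i j. has_bochner_integral lebesgue (\<lambda>x. \<rho> x * (homogenize x $ i * homogenize x $ j)) (?P $ i $ j)"
    using assms unfolding physically_consistent_iff by blast
  let ?q = "\<lambda>x. \<rho> x * (v \<bullet> homogenize x)\<^sup>2"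
  have "has_bochner_integral lebesgue
     (\<lambda>x. \<Sum>i\<in>UNIV. \<Sum>j\<in>UNIV. v $ i * v $ j * (\<rho> x * (homogenize x $ i * homogenize x $ j))) (v \<bullet> (?P *v v))"
    unfolding quadratic_form by (intro has_bochner_integral_sum has_bochner_integral_mult_right P)
  moreover have "(\<Sum>i\<in>UNIV. \<Sum>j\<in>UNIV. v $ i * v $ j * (\<rho> x * (homogenize x $ i * homogenize x $ j))) = ?q x" for x
    by (simp add: inner_vec_def power2_eq_square sum_product sum_distrib_left algebra_simps)
  ultimately have q: "has_bochner_integral lebesgue ?q (v \<bullet> (?P *v v))"
    by simp
  have "v \<bullet> (?P *v v) \<noteq> 0"
  proof
    assume "v \<bullet> (?P *v v) = 0"
    with q have "integrable lebesgue ?q" "integral\<^sup>L lebesgue ?q = 0"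
      by (simp_all add: has_bochner_integral_iff)
    then have "AE x in lebesgue. ?q x = 0"
      using \<rho> integral_nonneg_eq_0_iff_AE[of lebesgue ?q] by simp
    moreover have "AE x in lebesgue. v \<bullet> homogenize x \<noteq> 0"
      using negligible_homogenize[OF v] by (auto simp: negligible_iff_null_sets intro: AE_I')
    \<comment> \<open>Off the null hyperplane the density itself must vanish. It is written with the
      factors \<open>homogenize x $ 4\<close>, both equal to 1, to match the entry of
      \<open>?P\<close> that holds the mass.\<close>
    ultimately have "AE x in lebesgue. \<rho> x * (homogenize x $ 4 * homogenize x $ 4) = 0"
      by eventually_elim simp
    then have "integral\<^sup>L lebesgue (\<lambda>x. \<rho> x * (homogenize x $ 4 * homogenize x $ 4)) = 0"
      by (rule integral_eq_zero_AE)
    then have "?P $ 4 $ 4 = 0"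
      using P[of 4 4] by (simp add: has_bochner_integral_iff)
    then show False
      using m by (simp add: pseudo_inertia_def block_matrix_def)
  qed
  moreover have "0 \<le> v \<bullet> (?P *v v)"
    using \<rho> has_bochner_integral_integral_eq[OF q] Bochner_Integration.integral_nonneg[of lebesgue ?q]
    by simp
  ultimately show "0 < v \<bullet> (?P *v v)" by simp
qed

section \<open>Positive definiteness implies physical consistency\<close>

lemma physically_consistent_if_positive_definite:
  assumes "positive_definite (pseudo_inertia \<Phi>)"
  shows "physically_consistent \<Phi>"
proof -
  let ?P = "pseudo_inertia \<Phi>" and ?S = "Sigma_of_inertia (inertia \<Phi>)"
  define m where "m = mass \<Phi>"
  define h where "h = first_moment \<Phi>"
  have pos: "0 < v \<bullet> (?P *v v)" if "v \<noteq> 0" for v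
    using assms that by (simp add: positive_definite_def)
  have P: "?P = block_matrix ?S h m"
    by (simp add: pseudo_inertia_def m_def h_def)
  have m: "m > 0"
    using pos[of "vector [0, 0, 0, 1]"] by (simp add: P block_matrix_def quadratic_form sum_4 vec_eq_iff forall_4)
  have "?S \<in> sym_matrices"
    unfolding Sigma_of_inertia_def using inertia_sym by (rule sym_matrices_trace_diff)
  note S = sym_matrices_nth[OF this]
  define C where "C = (\<chi> i j. ?S $ i $ j - h $ i * h $ j / m)"
  have "positive_definite C"
    unfolding positive_definite_def
  proof (intro conjI allI impI)
    show "C \<in> sym_matrices"
      by (simp add: sym_matrices_def C_def transpose_def vec_eq_iff mult.commute S)
    fix v :: "real ^ 3" assume "v \<noteq> 0"
    \<comment> \<open>This t minimizes the form of \<open>?P\<close> over the last coordinate, and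
      the minimum is the form of \<open>C\<close> at v.\<close>
    let ?t = "- (h \<bullet> v) / m"
    let ?w = "vector [v $ 1, v $ 2, v $ 3, ?t] :: real ^ 4"
    have "0 < ?w \<bullet> (?P *v ?w)"
      using \<open>v \<noteq> 0\<close> by (intro pos) (auto simp: vec_eq_iff forall_3 forall_4)
    also have "?w \<bullet> (?P *v ?w) = v \<bullet> (?S *v v) + 2 * ?t * (h \<bullet> v) + m * ?t * ?t"
      unfolding P by (rule block_matrix_quadratic_form)
    also have "\<dots> = v \<bullet> (?S *v v) - (h \<bullet> v) * (h \<bullet> v) / m"
      using m by (simp add: field_simps)
    also have "\<dots> = v \<bullet> (C *v v)"
      unfolding quadratic_form using m by (simp add: C_def sum_3 inner_vec_def field_simps)
    finally show "0 < v \<bullet> (C *v v)" .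
  qed
  then obtain A :: "real ^ 3 ^ 3" where A: "C = A ** transpose A"
    by (rule cholesky_3)
  have C: "(transpose A *v a) \<bullet> (transpose A *v b) = a \<bullet> (C *v b)" for a b
    by (simp add: A matrix_vector_mul_assoc[symmetric] transpose_matrix_vector dot_lmul_matrix)
  \<comment> \<open>A kernel vector of \<open>transpose A\<close> would be a zero of the form of
    \<open>C\<close>, so definiteness makes A invertible.\<close>
  have "inj ((*v) (transpose A))"
  proof (rule injI)
    fix a b assume "transpose A *v a = transpose A *v b"
    then have "transpose A *v (a - b) = 0" by (simp add: matrix_vector_mult_diff_distrib)
    then have "(a - b) \<bullet> (C *v (a - b)) = 0" by (simp flip: C)
    then show "a = b" using \<open>positive_definite C\<close>
      unfolding positive_definite_def by (metis less_irrefl right_minus_eq)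
  qed
  then have "det A \<noteq> 0"
    using det_nz_iff_inj[of "(*v) (transpose A)"] by simp
  then obtain \<rho> where \<rho>: "\<rho> \<in> borel_measurable lebesgue" "\<And>x. 0 \<le> \<rho> x"
    "has_bochner_integral lebesgue \<rho> m"
    "\<And>a. has_bochner_integral lebesgue (\<lambda>x. \<rho> x * (x \<bullet> a)) (m * (((1/m) *\<^sub>R h) \<bullet> a))"
    "\<And>a b. has_bochner_integral lebesgue (\<lambda>x. \<rho> x * ((x \<bullet> a) * (x \<bullet> b)))
       (m * ((((1/m) *\<^sub>R h) \<bullet> a) * (((1/m) *\<^sub>R h) \<bullet> b)) + a \<bullet> (C *v b))"
    using ellipsoid_density[OF _ m, of A "(1/m) *\<^sub>R h", unfolded C] by blast
  have 1: "has_bochner_integral lebesgue (\<lambda>x. \<rho> x * x $ i) (h $ i)" for i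
    using \<rho>(4)[of "axis i 1"] m by (simp add: inner_axis)
  \<comment> \<open>With centre h / m, the contribution of the centre is h h^T / m, exactly what was
    subtracted in \<open>C\<close>.\<close>
  have 2: "has_bochner_integral lebesgue (\<lambda>x. \<rho> x * (x $ i * x $ j)) (?S $ i $ j)" for i j
    using \<rho>(5)[of "axis i 1" "axis j 1"] m
    by (simp add: inner_axis inner_axis' matrix_vector_mul_component C_def power2_eq_square)
  have "has_bochner_integral lebesgue (\<lambda>x. \<rho> x * (homogenize x $ i * homogenize x $ j)) (?P $ i $ j)" for i j
    using \<rho>(3) 1 2 exhaust_4[of i] exhaust_4[of j]
    by (auto simp: P block_matrix_def homogenize_def)
  then show ?thesis
    unfolding physically_consistent_iff using m \<rho>(1,2) m_def by blast
qed

text \<open>The inverse transformation appears both as an identity for the given parameters and as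
  the inverse of a bijection, so that the word inverse has its full meaning.\<close>

theorem theorem1:
  fixes \<Phi> :: "real ^ 10"
  shows "(physically_consistent \<Phi> \<longleftrightarrow> positive_definite (pseudo_inertia \<Phi>)) \<and>
    inertia \<Phi> = trace (upper_left_block (pseudo_inertia \<Phi>)) *\<^sub>R mat 1
                  - upper_left_block (pseudo_inertia \<Phi>) \<and>
    bij_betw Sigma_of_inertia sym_matrices sym_matrices \<and>
    (\<forall>S \<in> sym_matrices. inv_into sym_matrices Sigma_of_inertia S = trace S *\<^sub>R mat 1 - S)"
proof (intro conjI ballI)
  show "physically_consistent \<Phi> \<longleftrightarrow> positive_definite (pseudo_inertia \<Phi>)"
    using positive_definite_if_physically_consistent physically_consistent_if_positive_definite
    by blast
  show "inertia \<Phi> = trace (upper_left_block (pseudo_inertia \<Phi>)) *\<^sub>R mat 1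
      - upper_left_block (pseudo_inertia \<Phi>)"
    by (simp add: upper_left_block_pseudo_inertia Sigma_of_inertia_inverse)
  show bij: "bij_betw Sigma_of_inertia sym_matrices sym_matrices"
    by (rule bij_betw_byWitness[where f' = "\<lambda>S. trace S *\<^sub>R mat 1 - S"])
      (use Sigma_of_inertia_inverse sym_matrices_trace_diff Sigma_of_inertia_def in auto)
  fix S :: "real ^ 3 ^ 3" assume "S \<in> sym_matrices"
  then show "inv_into sym_matrices Sigma_of_inertia S = trace S *\<^sub>R mat 1 - S"
    using bij by (intro inv_into_f_eq)
      (auto simp: Sigma_of_inertia_inverse sym_matrices_trace_diff bij_betw_def)
qed

end
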